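(* Let $E$ be a countable set and let $\varepsilon=(\varepsilon_a)_{a\in E}$ be an i.i.d. family of exponential random variables with parameter $1$. Then, for any probability $p$ on $E$, there exists almost surely one and only one $a\in E$ such that $$\frac{\varepsilon_a}{p(a)}=\inf_{b\in E}\frac{\varepsilon_b}{p(b)},\qquad(\star)$$ with the convention that $\varepsilon_b/p(b)=+\infty$ if $p(b)=0$. Define $g(\varepsilon,p)$ (almost surely) as the only index $a$ such that $(\star)$ holds. Then: (i) for every probability $p$ on $E$, the law of the random variable $g(\varepsilon,p)$ is $p$; (ii) for all probabilities $p,q$ on $E$, $$\mathbb{P}[g(\varepsilon,p)\ne g(\varepsilon,q)]\le \frac{2\|p-q\|}{1+\|p-q\|}\le 2\|p-q\|.$$
   Context: For probabilities $p,q$ on a countable set $E$, $\|p-q\|=\frac12\sum_{a\in E}|p(a)-q(a)|$ is the total variation distance. *)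

theory Defs
  imports "HOL-Probability.Probability"
begin

text \<open>
  A probability on a countable set \<open>E\<close> is a \<open>pmf\<close> whose support is contained in \<open>E\<close>.
\<close>

definition tv_dist :: "'a set \<Rightarrow> 'a pmf \<Rightarrow> 'a pmf \<Rightarrow> real" where
  "tv_dist E p q = (\<Sum>\<^sub>\<infinity>a\<in>E. \<bar>pmf p a - pmf q a\<bar>) / 2"

definition ratio :: "('a \<Rightarrow> real) \<Rightarrow> 'a pmf \<Rightarrow> 'a \<Rightarrow> ereal" where
  "ratio x p b = (if pmf p b = 0 then \<infinity> else ereal (x b / pmf p b))"

definition attains_inf :: "'a set \<Rightarrow> ('a \<Rightarrow> real) \<Rightarrow> 'a pmf \<Rightarrow> 'a \<Rightarrow> bool" where
  "attains_inf E x p a \<longleftrightarrow> a \<in> E \<and> ratio x p a = (INF b\<in>E. ratio x p b)"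

text \<open>
  The minimising index is unique only almost surely.  On the exceptional null set the
  index is set to one fixed element of \<open>E\<close>, so that it is a measurable, \<open>E\<close>-valued function
  even if the underlying probability space is not complete.
\<close>

definition g :: "'a set \<Rightarrow> ('a \<Rightarrow> real) \<Rightarrow> 'a pmf \<Rightarrow> 'a" where
  "g E x p =
    (if \<exists>!a. attains_inf E x p a then (THE a. attains_inf E x p a) else (SOME a. a \<in> E))"

end

theory Submission
  imports Defs
begin

text \<open>
  Competing exponential clocks: if \<open>c a = 1\<close> then the event that \<open>c b * \<epsilon> a \<le> \<epsilon> b\<close> for all \<open>b\<close> has
  probability \<open>1 / (\<Sum>b. c b)\<close>.  For \<open>c b = p b / p a\<close> this is the probability \<open>p a\<close> that the infimum
  is attained at \<open>a\<close>.  These events are almost disjoint and their probabilities sum to \<open>1\<close>, so almost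
  surely exactly one of them occurs; this also covers the attainment of the infimum for infinite \<open>E\<close>.
  For \<open>c b = max (p b / p a) (q b / q a)\<close>, which is at most \<open>max (p b) (q b) / min (p a) (q a)\<close>, the
  infima for \<open>p\<close> and \<open>q\<close> are both attained at \<open>a\<close>, with probability at least
  \<open>min (p a) (q a) / (\<Sum>b. max (p b) (q b))\<close>.  Summing over \<open>a\<close>, the two indices agree with
  probability at least \<open>(1 - d) / (1 + d)\<close>, where \<open>d\<close> is the total variation distance.
\<close>

section \<open>Races between two independent exponential clocks\<close>

text \<open>Condition on \<open>X\<close>. For \<open>x \<ge> 0\<close> the tail
  \<open>exp (- x * m)\<close> of \<open>Y\<close> times the density of \<open>X\<close> at
  \<open>x\<close> is \<open>l / (l + m)\<close> times the exponential density of rate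
  \<open>l + m\<close>, which integrates to 1. For \<open>x < 0\<close> both densities
  vanish.\<close>

lemma (in prob_space) prob_exponential_less:
  assumes l: "0 < l" and m: "0 < m"
    and X: "distributed M lborel X (exponential_density l)"
    and Y: "distributed M lborel Y (exponential_density m)"
    and ind: "indep_var borel X borel Y"
  shows "prob {\<omega>\<in>space M. X \<omega> < Y \<omega>} = l / (l + m)"
proof -
  have [measurable]: "random_variable borel X" "random_variable borel Y"
    using ind by (auto dest: indep_var_rv1 indep_var_rv2)
  interpret Y: prob_space "distr M borel Y" by (rule prob_space_distr) simp
  have joint: "distr M borel X \<Otimes>\<^sub>M distr M borel Y = distr M (borel \<Otimes>\<^sub>M borel) (\<lambda>\<omega>. (X \<omega>, Y \<omega>))"
    using ind by (simp add: indep_var_distribution_eq)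
  have [measurable]: "{z::real \<times> real. fst z < snd z} \<in> sets (borel \<Otimes>\<^sub>M borel)"
    unfolding borel_prod by (intro borel_open open_Collect_less continuous_intros)
  have tail: "emeasure M {\<omega>\<in>space M. x < Y \<omega>} * exponential_density l x
      = ennreal (l / (l + m)) * exponential_density (l + m) x" for x
  proof (cases "x < 0")
    case False
    then have "emeasure M {\<omega>\<in>space M. x < Y \<omega>} = ennreal (exp (- x * m))"
      using exponential_distributedD_gt[OF Y _ m, of x] by (simp add: emeasure_eq_measure)
    moreover have "exp (- x * m) * (l * exp (- x * l)) = l / (l + m) * ((l + m) * exp (- x * (l + m)))"
      using l m exp_add[of "- x * l" "- x * m"] by (simp add: distrib_left[of x])
    ultimately show ?thesis
      using False l m by (simp add: exponential_density_def ennreal_mult[symmetric])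
  qed (simp add: exponential_density_def)
  have "emeasure M {\<omega>\<in>space M. X \<omega> < Y \<omega>}
      = emeasure (distr M (borel \<Otimes>\<^sub>M borel) (\<lambda>\<omega>. (X \<omega>, Y \<omega>))) {z. fst z < snd z}"
    by (subst emeasure_distr) (auto intro!: arg_cong[where f="emeasure M"])
  also have "\<dots> = (\<integral>\<^sup>+x. emeasure (distr M borel Y) (Pair x -` {z. fst z < snd z}) \<partial>distr M borel X)"
    unfolding joint[symmetric]
    by (rule Y.emeasure_pair_measure_alt) (simp add: sets_pair_measure_cong[OF sets_distr sets_distr])
  also have "\<dots> = (\<integral>\<^sup>+x. emeasure M {\<omega>\<in>space M. x < Y \<omega>} \<partial>distr M borel X)"
    by (intro nn_integral_cong, subst emeasure_distr) (auto intro!: arg_cong[where f="emeasure M"])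
  also have "distr M borel X = density lborel (exponential_density l)"
    using X by (simp add: distributed_def cong: distr_cong)
  also have "(\<integral>\<^sup>+x. emeasure M {\<omega>\<in>space M. x < Y \<omega>} \<partial>density lborel (exponential_density l))
      = (\<integral>\<^sup>+x. emeasure M {\<omega>\<in>space M. x < Y \<omega>} * exponential_density l x \<partial>lborel)"
    by (subst nn_integral_density) (auto simp: mult.commute)
  also have "\<dots> = ennreal (l / (l + m)) * (\<integral>\<^sup>+x. exponential_density (l + m) x \<partial>lborel)"
    unfolding tail by (rule nn_integral_cmult) simp
  also have "(\<integral>\<^sup>+x. exponential_density (l + m) x \<partial>lborel) = 1"
    using prob_space.emeasure_space_1[OF prob_space_exponential_density, of "l + m"] l m
    by (simp add: emeasure_density)
  finally show ?thesis
    using l m by (simp add: measure_def)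
qed

lemma (in prob_space) indep_set_commute:
  assumes "indep_set A B"
  shows "indep_set B A"
  unfolding indep_sets2_eq
proof (intro conjI ballI)
  fix b a assume "b \<in> B" "a \<in> A"
  then show "prob (b \<inter> a) = prob b * prob a"
    using indep_setD[OF assms, of a b] by (simp add: Int_commute mult.commute)
qed (rule indep_setD_ev1[OF assms] indep_setD_ev2[OF assms])+

lemma (in prob_space) indep_var_commute: "indep_var S X T Y \<Longrightarrow> indep_var T Y S X"
  by (auto simp: indep_var_eq intro: indep_set_commute)

text \<open>The two strict orders already have probabilities \<open>l / (l + m)\<close> and
  \<open>m / (l + m)\<close>, which sum to 1, so nothing is left for ties.\<close>

lemma (in prob_space) AE_exponential_neq:
  assumes l: "0 < l" and m: "0 < m"
    and X: "distributed M lborel X (exponential_density l)"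
    and Y: "distributed M lborel Y (exponential_density m)"
    and ind: "indep_var borel X borel Y"
  shows "AE \<omega> in M. X \<omega> \<noteq> Y \<omega>"
proof -
  have [measurable]: "random_variable borel X" "random_variable borel Y"
    using ind by (auto dest: indep_var_rv1 indep_var_rv2)
  have "prob ({\<omega>\<in>space M. X \<omega> < Y \<omega>} \<union> {\<omega>\<in>space M. Y \<omega> < X \<omega>}) =
      prob {\<omega>\<in>space M. X \<omega> < Y \<omega>} + prob {\<omega>\<in>space M. Y \<omega> < X \<omega>}"
    by (intro finite_measure_Union) auto
  also have "\<dots> = 1"
    using prob_exponential_less[OF l m X Y ind]
      prob_exponential_less[OF m l Y X indep_var_commute[OF ind]] l m
    by (simp add: add_divide_distrib[symmetric] add.commute)
  finally show ?thesis
    by (subst (asm) prob_eq_1) (auto elim!: AE_mp)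
qed

text \<open>Read off from the distribution function. It turns a ratio
  \<open>\<epsilon> a / pmf p a\<close> into a clock of rate \<open>pmf p a\<close>.\<close>

lemma (in prob_space) distributed_exponential_divide:
  assumes X: "distributed M lborel X (exponential_density l)" and l: "0 < l" and c: "0 < c"
  shows "distributed M lborel (\<lambda>\<omega>. X \<omega> / c) (exponential_density (l * c))"
proof -
  have "prob {\<omega>\<in>space M. X \<omega> / c \<le> a} = 1 - exp (- a * (l * c))" if "0 \<le> a" for a
    using exponential_distributedD_le[OF X _ l, of "a * c"] that c
    by (simp add: field_simps)
  then show ?thesis
    using X l c by (auto simp: exponential_distributed_iff)
qed

section \<open>Races between finitely and countably many weighted clocks\<close>

text \<open>Dividing each \<open>X j\<close> by its weight gives clocks of rate \<open>c j\<close>.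
  Their minimum over \<open>I\<close> is exponential with the summed rate and independent of
  \<open>X i\<close>, so only a race between two clocks remains.\<close>

lemma (in prob_space) prob_exponential_le_finite:
  fixes X :: "'i \<Rightarrow> 'a \<Rightarrow> real"
  assumes I: "finite I" "i \<notin> I" and c: "\<And>j. j \<in> I \<Longrightarrow> 0 < c j"
    and ind: "indep_vars (\<lambda>_. borel) X (insert i I)"
    and X: "\<And>j. j \<in> insert i I \<Longrightarrow> distributed M lborel (X j) (exponential_density 1)"
  shows "prob {\<omega>\<in>space M. \<forall>j\<in>I. c j * X i \<omega> \<le> X j \<omega>} = 1 / (1 + (\<Sum>j\<in>I. c j))"
proof (cases "I = {}")
  case False
  \<comment> \<open>The hypotheses say nothing about \<open>c i\<close>; setting it to 1 lets
    \<open>X i\<close> be rescaled along with the others without changing it.\<close>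
  define d where "d = c(i := 1)"
  define Z where "Z j \<omega> = X j \<omega> / d j" for j \<omega>
  have d: "0 < d j" if "j \<in> insert i I" for j
    using c that by (auto simp: d_def)
  have Z: "distributed M lborel (Z j) (exponential_density (d j))" if "j \<in> insert i I" for j
    using distributed_exponential_divide[OF X[OF that] _ d[OF that]] by (simp add: Z_def[abs_def])
  have indZ: "indep_vars (\<lambda>_. borel) Z (insert i I)"
    unfolding Z_def[abs_def] by (rule indep_vars_compose2[OF ind]) simp
  define Y where "Y \<omega> = Min ((\<lambda>j. Z j \<omega>) ` I)" for \<omega>
  have indY: "indep_var borel (Z i) borel Y"
    unfolding Y_def[abs_def] by (rule indep_vars_Min[OF I indZ])
  have Y: "distributed M lborel Y (exponential_density (\<Sum>j\<in>I. d j))"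
    unfolding Y_def[abs_def]
    by (rule exponential_distributed_Min) (use I False d Z indZ in \<open>auto intro: indep_vars_subset\<close>)
  have Zi: "distributed M lborel (Z i) (exponential_density 1)"
    using Z[of i] by (simp add: d_def)
  have pos: "0 < (\<Sum>j\<in>I. d j)"
    using I False d by (intro sum_pos) auto
  have sum: "(\<Sum>j\<in>I. d j) = (\<Sum>j\<in>I. c j)"
    using I by (intro sum.cong) (auto simp: d_def)
  have [measurable]: "random_variable borel (Z i)" "random_variable borel Y"
    using indY by (auto dest: indep_var_rv1 indep_var_rv2)
  have Xm[measurable]: "random_variable borel (X j)" if "j \<in> insert i I" for j
    using distributed_measurable[OF X[OF that]] by simp
  have le: "Z i \<omega> \<le> Y \<omega> \<longleftrightarrow> (\<forall>j\<in>I. c j * X i \<omega> \<le> X j \<omega>)" for \<omega>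
    unfolding Y_def using I False c
    by (subst Min_ge_iff) (auto simp: Z_def d_def field_simps)
  have [measurable]: "{\<omega>\<in>space M. \<forall>j\<in>I. c j * X i \<omega> \<le> X j \<omega>} \<in> events"
    using I unfolding le[symmetric] by measurable
  \<comment> \<open>Ties are null, so the weak inequality may be replaced by the strict one.\<close>
  have "prob {\<omega>\<in>space M. \<forall>j\<in>I. c j * X i \<omega> \<le> X j \<omega>} = prob {\<omega>\<in>space M. Z i \<omega> < Y \<omega>}"
    using AE_exponential_neq[OF _ pos Zi Y indY]
    by (intro finite_measure_eq_AE) (auto simp: le[symmetric])
  also have "\<dots> = 1 / (1 + (\<Sum>j\<in>I. c j))"
    using prob_exponential_less[OF _ pos Zi Y indY] sum by simp
  finally show ?thesis .
qed (simp add: prob_space)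

text \<open>
  Indices with \<open>c j = 0\<close> are left unconstrained, because the inequality \<open>0 \<le> X j\<close> may fail on a
  null set, whereas an infinite ratio never competes for the infimum.
\<close>
lemma (in prob_space) prob_exponential_le:
  fixes X :: "'i \<Rightarrow> 'a \<Rightarrow> real"
  assumes I: "countable I" "i \<in> I" and c: "\<And>j. j \<in> I \<Longrightarrow> 0 \<le> c j" "c i = 1"
    and s: "(c has_sum s) I"
    and ind: "indep_vars (\<lambda>_. borel) X I"
    and X: "\<And>j. j \<in> I \<Longrightarrow> distributed M lborel (X j) (exponential_density 1)"
  shows "prob {\<omega>\<in>space M. \<forall>j\<in>I. 0 < c j \<longrightarrow> c j * X i \<omega> \<le> X j \<omega>} = 1 / s"
proof -
  define J where "J = {j\<in>I. 0 < c j}"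
  define A where "A F = {\<omega>\<in>space M. \<forall>j\<in>F. c j * X i \<omega> \<le> X j \<omega>}" for F
  have J: "countable J" "i \<in> J" "J \<subseteq> I"
    using I c by (auto simp: J_def)
  have Xm[measurable]: "random_variable borel (X j)" if "j \<in> I" for j
    using distributed_measurable[OF X[OF that]] by simp
  have Am: "A F \<in> events" if "F \<subseteq> J" for F
  proof -
    have "countable F" using that J countable_subset by blast
    moreover have "{\<omega>\<in>space M. c j * X i \<omega> \<le> X j \<omega>} \<in> events" if "j \<in> F" for j
    proof -
      have [measurable]: "random_variable borel (X i)" "random_variable borel (X j)"
        using Xm I J that \<open>F \<subseteq> J\<close> by auto
      show ?thesis by measurable
    qed
    ultimately show ?thesis
      unfolding A_def by (intro sets.sets_Collect_countable_All') auto
  qed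
  have sJ: "(c has_sum s) J"
    using s c(1) by (subst has_sum_cong_neutral[of I J c c]) (auto simp: J_def not_less intro: antisym)
  have fin: "prob (A F) = 1 / sum c F" if F: "finite F" "i \<in> F" "F \<subseteq> J" for F
  proof -
    \<comment> \<open>The constraint at \<open>i\<close> itself reads
      \<open>X i \<omega> \<le> X i \<omega>\<close>, because \<open>c i = 1\<close>. Removing it
      leaves the event of the finite lemma.\<close>
    have "prob {\<omega>\<in>space M. \<forall>j\<in>F - {i}. c j * X i \<omega> \<le> X j \<omega>} = 1 / (1 + sum c (F - {i}))"
      by (rule prob_exponential_le_finite)
         (use F J I in \<open>auto simp: J_def insert_absorb intro: X indep_vars_subset[OF ind]\<close>)
    moreover have "{\<omega>\<in>space M. \<forall>j\<in>F - {i}. c j * X i \<omega> \<le> X j \<omega>} = A F"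
      using c by (auto simp: A_def)
    moreover have "1 + sum c (F - {i}) = sum c F"
      using F c by (simp add: sum.remove[of F i])
    ultimately show ?thesis by simp
  qed
  have mono: "sum c F \<le> s" if "finite F" "F \<subseteq> J" for F
    using finite_sum_le_has_sum[OF sJ that] c J by auto
  have s1: "1 \<le> s"
    using mono[of "{i}"] c J by simp
  have pos: "1 \<le> sum c F" if "finite F" "F \<subseteq> J" "i \<in> F" for F
    using that c member_le_sum[of i F c] J by auto
  \<comment> \<open>\<open>e\<close> enumerates \<open>J\<close>, possibly with repetitions. The
    sets \<open>G n\<close> are finite, increase to \<open>J\<close> and always contain
    \<open>i\<close>, as \<open>fin\<close> requires; the events \<open>A (G n)\<close> therefore
    decrease to \<open>A J\<close>.\<close>
  define e where "e = from_nat_into J"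
  have e: "range e = J"
    unfolding e_def using J by (intro range_from_nat_into) auto
  define G where "G n = insert i (e ` {..n})" for n
  have G: "finite (G n)" "i \<in> G n" "G n \<subseteq> J" for n
    using e J by (auto simp: G_def)
  have "(\<lambda>n. prob (A (G n))) \<longlonglongrightarrow> prob (\<Inter>n. A (G n))"
  proof (rule finite_Lim_measure_decseq)
    show "decseq (\<lambda>n. A (G n))"
      by (auto simp: decseq_def A_def G_def)
  qed (use Am G in auto)
  moreover have "(\<Inter>n. A (G n)) = A J"
    using e J by (auto simp: A_def G_def)
  ultimately have lim: "(\<lambda>n. prob (A (G n))) \<longlonglongrightarrow> prob (A J)" by simp
  \<comment> \<open>Partial sums are at most \<open>s\<close>, so the bound holds along the sequence
    and passes to the limit.\<close>
  have "1 / s \<le> prob (A J)"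
  proof (rule LIMSEQ_le_const[OF lim], intro exI allI impI)
    fix n
    show "1 / s \<le> prob (A (G n))"
      unfolding fin[OF G] using mono[OF G(1,3), of n] pos[OF G(1,3,2), of n] by (intro frac_le) auto
  qed
  \<comment> \<open>Since \<open>A J\<close> lies in every \<open>A (insert i F)\<close>, each
    partial sum is at most \<open>1 / prob (A J)\<close>, and hence so is \<open>s\<close>. The
    lower bound just proved gives the positivity that this division needs.\<close>
  moreover have "prob (A J) \<le> 1 / s"
  proof -
    have Apos: "0 < prob (A J)"
    proof (rule less_le_trans)
      show "0 < 1 / s" using s1 by simp
    qed fact
    have "s \<le> 1 / prob (A J)"
    proof (rule has_sum_le_finite_sums[OF sJ])
      fix F assume F: "finite F" "F \<subseteq> J"
      have "prob (A J) \<le> prob (A (insert i F))"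
        using F J by (intro finite_measure_mono Am) (auto simp: A_def)
      then have "prob (A J) \<le> 1 / sum c (insert i F)"
        using fin[of "insert i F"] F J by simp
      moreover have "1 \<le> sum c (insert i F)"
        using pos[of "insert i F"] F J by simp
      ultimately have "sum c (insert i F) \<le> 1 / prob (A J)"
        using Apos by (simp add: pos_le_divide_eq mult.commute)
      moreover have "sum c F \<le> sum c (insert i F)"
        using F c J by (intro sum_mono2) auto
      ultimately show "sum c F \<le> 1 / prob (A J)" by simp
    qed
    then show ?thesis using Apos s1 by (simp add: pos_le_divide_eq mult.commute)
  qed
  ultimately have "prob (A J) = 1 / s" by simp
  moreover have "A J = {\<omega>\<in>space M. \<forall>j\<in>I. 0 < c j \<longrightarrow> c j * X i \<omega> \<le> X j \<omega>}"
    by (auto simp: A_def J_def)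
  ultimately show ?thesis by simp
qed

section \<open>Sums of probability weights and the total variation distance\<close>

lemma has_sum_pmf:
  assumes "set_pmf p \<subseteq> E"
  shows "(pmf p has_sum 1) E"
proof -
  have "pmf p summable_on E"
    using pmf_abs_summable[of p E] abs_summable_equivalent[of "pmf p" E] by simp
  then show ?thesis
    using infsetsum_pmf_eq_1[OF assms] infsetsum_infsum[OF pmf_abs_summable, of p E]
    by (simp add: has_sum_iff)
qed

text \<open>Maximum and minimum are half of the sum plus or minus the absolute difference. Over
  \<open>E\<close> the sum \<open>pmf p a + pmf q a\<close> contributes 2 and the absolute
  difference contributes twice the distance.\<close>

lemma
  assumes p: "set_pmf p \<subseteq> E" and q: "set_pmf q \<subseteq> E"
  shows has_sum_max_pmf: "((\<lambda>a. max (pmf p a) (pmf q a)) has_sum (1 + tv_dist E p q)) E"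
    and has_sum_min_pmf: "((\<lambda>a. min (pmf p a) (pmf q a)) has_sum (1 - tv_dist E p q)) E"
proof -
  let ?D = "\<lambda>a. \<bar>pmf p a - pmf q a\<bar>"
  have add: "((\<lambda>a. pmf p a + pmf q a) has_sum (1 + 1)) E"
    by (intro has_sum_add has_sum_pmf p q)
  have "?D summable_on E"
    by (rule summable_on_comparison_test[OF has_sum_imp_summable[OF add]])
       (auto simp: abs_le_iff intro: order_trans[OF _ pmf_nonneg])
  then have D: "(?D has_sum (2 * tv_dist E p q)) E"
    by (simp add: tv_dist_def has_sum_infsum)
  have max: "max x y = (1/2) * ((x + y) + \<bar>x - y\<bar>)" and min: "min x y = (1/2) * ((x + y) - \<bar>x - y\<bar>)"
    for x y :: real by auto
  show "((\<lambda>a. max (pmf p a) (pmf q a)) has_sum (1 + tv_dist E p q)) E"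
    using has_sum_cmult_right[OF has_sum_add[OF add D], of "1/2"]
    unfolding max by (simp add: add_divide_distrib)
  show "((\<lambda>a. min (pmf p a) (pmf q a)) has_sum (1 - tv_dist E p q)) E"
    using has_sum_cmult_right[OF has_sum_add[OF add has_sum_uminusI[OF D]], of "1/2"]
    unfolding min by (simp add: diff_divide_distrib)
qed

lemma tv_dist_nonneg: "0 \<le> tv_dist E p q"
  by (simp add: tv_dist_def infsum_nonneg)

section \<open>Pointwise properties of minimising indices and of \<open>g\<close>\<close>

lemma attains_inf_iff:
  "attains_inf E x p a \<longleftrightarrow> a \<in> E \<and> (\<forall>b\<in>E. ratio x p a \<le> ratio x p b)"
  unfolding attains_inf_def by (auto intro!: antisym INF_lower INF_greatest)

text \<open>Cross-multiplication brings minimality into the shape of the event in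
  \<open>prob_exponential_le\<close>. The guard drops exactly the indices of zero mass, whose
  infinite ratio imposes no constraint.\<close>

lemma attains_inf_iff_scaled:
  assumes "a \<in> E" "0 < pmf p a"
  shows "attains_inf E x p a \<longleftrightarrow>
    (\<forall>b\<in>E. 0 < pmf p b / pmf p a \<longrightarrow> pmf p b / pmf p a * x a \<le> x b)"
  unfolding attains_inf_iff using assms
  by (auto simp: ratio_def field_simps zero_less_mult_iff order_less_le)

text \<open>The support of \<open>p\<close> is nonempty, so some ratio is finite and an infinite one
  cannot be minimal.\<close>

lemma attains_inf_imp_pmf_pos:
  assumes "set_pmf p \<subseteq> E" "attains_inf E x p a"
  shows "0 < pmf p a"
proof -
  obtain b where "b \<in> set_pmf p"
    using set_pmf_not_empty[of p] by blast
  then have "ratio x p a \<le> ratio x p b" "pmf p b \<noteq> 0"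
    using assms by (auto simp: attains_inf_iff set_pmf_iff)
  then show ?thesis
    by (auto simp: ratio_def order_less_le split: if_splits)
qed

lemma g_in: "E \<noteq> {} \<Longrightarrow> g E x p \<in> E"
  using theI'[of "attains_inf E x p"]
  by (auto simp: g_def attains_inf_iff some_in_eq)

lemma g_eq_iff: "\<exists>!a. attains_inf E x p a \<Longrightarrow> g E x p = a \<longleftrightarrow> attains_inf E x p a"
  unfolding g_def by (auto intro: the1_equality theI')

lemma g_eq_default: "\<not> (\<exists>!a. attains_inf E x p a) \<Longrightarrow> g E x p = (SOME a. a \<in> E)"
  unfolding g_def by (rule if_not_P)

section \<open>The family of clocks on \<open>E\<close> and measurability of its minimisers\<close>

locale exponential_clocks = prob_space M for M :: "'w measure" +
  fixes E :: "'a set" and \<epsilon> :: "'a \<Rightarrow> 'w \<Rightarrow> real"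
  assumes countable_E: "countable E"
    and indep: "indep_vars (\<lambda>_. borel) \<epsilon> E"
    and exponential: "\<And>a. a \<in> E \<Longrightarrow> distributed M lborel (\<epsilon> a) (exponential_density 1)"
begin

abbreviation attains :: "'a pmf \<Rightarrow> 'w \<Rightarrow> 'a \<Rightarrow> bool" where
  "attains p \<omega> a \<equiv> attains_inf E (\<lambda>b. \<epsilon> b \<omega>) p a"

lemma measurable_clock [measurable]: "a \<in> E \<Longrightarrow> random_variable borel (\<epsilon> a)"
  using distributed_measurable[OF exponential] by simp

text \<open>Positivity is what makes a constraint with a larger weight imply the one with a smaller
  weight.\<close>

lemma AE_clock_pos:
  assumes "a \<in> E"
  shows "AE \<omega> in M. 0 < \<epsilon> a \<omega>"
proof -
  have "prob {\<omega>\<in>space M. 0 < \<epsilon> a \<omega>} = 1"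
    using exponential_distributedD_gt[OF exponential[OF assms], of 0] by simp
  then show ?thesis
    using assms by (subst (asm) prob_Collect_eq_1) auto
qed

lemma measurable_ratio [measurable]:
  "a \<in> E \<Longrightarrow> (\<lambda>\<omega>. ratio (\<lambda>b. \<epsilon> b \<omega>) p a) \<in> borel_measurable M"
  unfolding ratio_def by measurable

lemma measurable_attains [measurable]: "Measurable.pred M (\<lambda>\<omega>. attains p \<omega> a)"
proof (cases "a \<in> E")
  case True
  then show ?thesis
    unfolding attains_inf_iff pred_def
    by (intro sets.sets_Collect_conj sets.sets_Collect_const sets.sets_Collect_countable_All' countable_E)
       measurable
qed (simp add: attains_inf_iff)

lemma measurable_unique [measurable]: "Measurable.pred M (\<lambda>\<omega>. \<exists>!a. attains p \<omega> a)"
proof -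
  \<comment> \<open>A minimiser lies in \<open>E\<close>, so the quantifiers can be restricted to a
    countable set.\<close>
  have eq: "(\<exists>!a. attains p \<omega> a) \<longleftrightarrow> (\<exists>a\<in>E. attains p \<omega> a \<and> (\<forall>b\<in>E. attains p \<omega> b \<longrightarrow> b = a))" for \<omega>
    unfolding Ex1_def Bex_def by (auto simp: attains_inf_iff)
  show ?thesis
    unfolding eq pred_def
    by (intro sets.sets_Collect_countable_Ex' sets.sets_Collect_conj sets.sets_Collect_countable_All' countable_E)
       measurable
qed

section \<open>Law and almost sure uniqueness of the minimiser\<close>

lemma prob_attains:
  assumes p: "set_pmf p \<subseteq> E" and a: "a \<in> E"
  shows "prob {\<omega>\<in>space M. attains p \<omega> a} = pmf p a"
proof (cases "pmf p a = 0")
  case True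
  then have "{\<omega>\<in>space M. attains p \<omega> a} = {}"
    using attains_inf_imp_pmf_pos[OF p] by fastforce
  then show ?thesis
    unfolding \<open>{\<omega>\<in>space M. attains p \<omega> a} = {}\<close> using True by simp
next
  case False
  then have pos: "0 < pmf p a"
    by (simp add: order_less_le)
  \<comment> \<open>These weights equal 1 at \<open>a\<close> and sum to \<open>1 / pmf p a\<close>,
    whose reciprocal is the desired probability.\<close>
  have "((\<lambda>b. pmf p b / pmf p a) has_sum (1 / pmf p a)) E"
    using has_sum_cmult_left[OF has_sum_pmf[OF p], of "1 / pmf p a"] by simp
  from prob_exponential_le[OF countable_E a _ _ this indep exponential] show ?thesis
    using pos a by (simp add: attains_inf_iff_scaled)
qed

text \<open>Two minimisers have equal ratios, which is a tie between independent exponential clocks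
  of rates \<open>pmf p a\<close> and \<open>pmf p b\<close>. An index of zero mass is never a
  minimiser.\<close>

lemma AE_not_attains_both:
  assumes p: "set_pmf p \<subseteq> E" and ab: "a \<in> E" "b \<in> E" "a \<noteq> b"
  shows "AE \<omega> in M. \<not> (attains p \<omega> a \<and> attains p \<omega> b)"
proof (cases "0 < pmf p a \<and> 0 < pmf p b")
  case True
  define Z where "Z c \<omega> = \<epsilon> c \<omega> / pmf p c" for c \<omega>
  have Z: "distributed M lborel (Z c) (exponential_density (pmf p c))" if "c \<in> {a, b}" for c
    using distributed_exponential_divide[OF exponential, of c "pmf p c"] that True ab
    by (auto simp: Z_def[abs_def])
  have "indep_vars (\<lambda>_. borel) Z (insert a {b})"
    unfolding Z_def[abs_def]
    by (rule indep_vars_compose2[OF indep_vars_subset[OF indep]]) (use ab in auto)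
  \<comment> \<open>Independence of the pair comes from the minimum over the singleton
    \<open>{b}\<close>, which is \<open>Z b\<close> itself.\<close>
  then have "indep_var borel (Z a) borel (Z b)"
    using indep_vars_Min[of "{b}" a Z] ab by simp
  from AE_exponential_neq[OF _ _ Z Z this] True have "AE \<omega> in M. Z a \<omega> \<noteq> Z b \<omega>"
    by simp
  then show ?thesis
  proof eventually_elim
    case (elim \<omega>)
    show ?case
    proof
      assume "attains p \<omega> a \<and> attains p \<omega> b"
      then have "ratio (\<lambda>b. \<epsilon> b \<omega>) p a = ratio (\<lambda>b. \<epsilon> b \<omega>) p b"
        by (auto simp: attains_inf_iff intro: antisym)
      with elim True show False
        by (simp add: ratio_def Z_def)
    qed
  qed
next
  case False
  then show ?thesis
    using attains_inf_imp_pmf_pos[OF p] by (auto intro!: AE_I2)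
qed

lemma AE_unique:
  assumes p: "set_pmf p \<subseteq> E"
  shows "AE \<omega> in M. \<exists>!a. attains p \<omega> a"
proof -
  have [measurable]: "{\<omega>\<in>space M. \<exists>a\<in>E. attains p \<omega> a} \<in> events"
    by (intro sets.sets_Collect_countable_Ex' countable_E) measurable
  \<comment> \<open>Existence: each finite partial sum of \<open>pmf p\<close> is the probability of
    an almost disjoint union contained in this event, so the total mass 1 is a lower bound
    too.\<close>
  have "1 \<le> prob {\<omega>\<in>space M. \<exists>a\<in>E. attains p \<omega> a}"
  proof (rule has_sum_le_finite_sums[OF has_sum_pmf[OF p]])
    fix F assume F: "finite F" "F \<subseteq> E"
    have "pairwise (\<lambda>a b. AE \<omega> in M. \<omega> \<notin> {\<omega>\<in>space M. attains p \<omega> a} \<or> \<omega> \<notin> {\<omega>\<in>space M. attains p \<omega> b}) F"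
    proof (rule pairwiseI)
      fix a b assume "a \<in> F" "b \<in> F" "a \<noteq> b"
      with F have "AE \<omega> in M. \<not> (attains p \<omega> a \<and> attains p \<omega> b)"
        by (intro AE_not_attains_both[OF p]) auto
      then show "AE \<omega> in M. \<omega> \<notin> {\<omega>\<in>space M. attains p \<omega> a} \<or> \<omega> \<notin> {\<omega>\<in>space M. attains p \<omega> b}"
        by eventually_elim auto
    qed
    then have "prob (\<Union>a\<in>F. {\<omega>\<in>space M. attains p \<omega> a}) = (\<Sum>a\<in>F. prob {\<omega>\<in>space M. attains p \<omega> a})"
      by (intro measure_UNION_AE F) (simp add: fmeasurable_eq_sets)
    also have "\<dots> = sum (pmf p) F"
      using F by (intro sum.cong) (auto intro!: prob_attains[OF p])
    finally show "sum (pmf p) F \<le> prob {\<omega>\<in>space M. \<exists>a\<in>E. attains p \<omega> a}"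
      using F by (auto intro!: finite_measure_mono elim!: ord_eq_le_trans[OF sym])
  qed
  then have "prob {\<omega>\<in>space M. \<exists>a\<in>E. attains p \<omega> a} = 1"
    by (intro antisym) auto
  then have "AE \<omega> in M. \<exists>a\<in>E. attains p \<omega> a"
    by (subst (asm) prob_Collect_eq_1) auto
  \<comment> \<open>Uniqueness: there are only countably many pairs, so the null sets of
    \<open>AE_not_attains_both\<close> can be collected into one.\<close>
  moreover have "AE \<omega> in M. \<forall>a\<in>E. \<forall>b\<in>E. a \<noteq> b \<longrightarrow> \<not> (attains p \<omega> a \<and> attains p \<omega> b)"
    using AE_not_attains_both[OF p] by (intro AE_ball_countable' countable_E) auto
  ultimately show ?thesis
  proof eventually_elim
    case (elim \<omega>)
    then obtain a where a: "a \<in> E" "attains p \<omega> a" by blast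
    show ?case
    proof (rule ex1I[of _ a])
      fix b assume b: "attains p \<omega> b"
      then have "b \<in> E" by (simp add: attains_inf_iff)
      with a b elim(2) show "b = a" by metis
    qed fact
  qed
qed

lemma measurable_g:
  assumes "E \<noteq> {}"
  shows "(\<lambda>\<omega>. g E (\<lambda>b. \<epsilon> b \<omega>) p) \<in> measurable M (count_space E)"
  unfolding measurable_count_space_eq_countable[OF countable_E]
proof (intro conjI ballI)
  fix a
  \<comment> \<open>The preimage of \<open>{a}\<close> is split by uniqueness: where it holds,
    \<open>g\<close> is \<open>a\<close> exactly when \<open>a\<close> is a minimiser; elsewhere
    \<open>g\<close> is the fixed default element.\<close>
  have "{\<omega>\<in>space M. (if \<exists>!a. attains p \<omega> a then attains p \<omega> a else (SOME a. a \<in> E) = a)} \<in> events"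
    by measurable
  also have "{\<omega>\<in>space M. (if \<exists>!a. attains p \<omega> a then attains p \<omega> a else (SOME a. a \<in> E) = a)}
      = (\<lambda>\<omega>. g E (\<lambda>b. \<epsilon> b \<omega>) p) -` {a} \<inter> space M"
  proof (intro set_eqI)
    fix \<omega>
    show "\<omega> \<in> {\<omega>\<in>space M. (if \<exists>!a. attains p \<omega> a then attains p \<omega> a else (SOME a. a \<in> E) = a)}
        \<longleftrightarrow> \<omega> \<in> (\<lambda>\<omega>. g E (\<lambda>b. \<epsilon> b \<omega>) p) -` {a} \<inter> space M"
      by (cases "\<exists>!a. attains p \<omega> a") (simp_all only: g_eq_iff g_eq_default mem_Collect_eq vimage_eq
          Int_iff singleton_iff if_True if_False conj_commute simp_thms)
  qed
  finally show "(\<lambda>\<omega>. g E (\<lambda>b. \<epsilon> b \<omega>) p) -` {a} \<inter> space M \<in> events" .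
qed (use g_in[OF assms] in auto)

text \<open>Both measures live on the countable set \<open>E\<close>, so it suffices to compare
  singletons. Almost surely \<open>g\<close> takes the value \<open>a\<close> exactly when
  \<open>a\<close> attains the infimum.\<close>

lemma distr_g:
  assumes p: "set_pmf p \<subseteq> E"
  shows "distr M (count_space UNIV) (\<lambda>\<omega>. g E (\<lambda>b. \<epsilon> b \<omega>) p) = measure_pmf p"
proof -
  have ne: "E \<noteq> {}" using p set_pmf_not_empty[of p] by auto
  have gE [measurable]: "(\<lambda>\<omega>. g E (\<lambda>b. \<epsilon> b \<omega>) p) \<in> measurable M (count_space E)"
    by (rule measurable_g[OF ne])
  have gU [measurable]: "(\<lambda>\<omega>. g E (\<lambda>b. \<epsilon> b \<omega>) p) \<in> measurable M (count_space UNIV)"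
    by (rule measurable_compose[OF gE]) simp
  show ?thesis
  proof (rule measure_eqI_countable_AE[OF _ _ _ _ countable_E])
    show "AE a in distr M (count_space UNIV) (\<lambda>\<omega>. g E (\<lambda>b. \<epsilon> b \<omega>) p). a \<in> E"
      by (subst AE_distr_iff) (auto simp: g_in[OF ne])
    show "AE a in measure_pmf p. a \<in> E"
      using p by (auto simp: AE_measure_pmf_iff)
    fix a assume a: "a \<in> E"
    have "prob {\<omega>\<in>space M. g E (\<lambda>b. \<epsilon> b \<omega>) p = a} = prob {\<omega>\<in>space M. attains p \<omega> a}"
    proof (rule finite_measure_eq_AE)
      show "AE \<omega> in M. \<omega> \<in> {\<omega>\<in>space M. g E (\<lambda>b. \<epsilon> b \<omega>) p = a} \<longleftrightarrow> \<omega> \<in> {\<omega>\<in>space M. attains p \<omega> a}"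
        using AE_unique[OF p] by eventually_elim (auto simp: g_eq_iff)
    qed measurable
    then have "emeasure M {\<omega>\<in>space M. g E (\<lambda>b. \<epsilon> b \<omega>) p = a} = pmf p a"
      using prob_attains[OF p a] by (simp add: emeasure_eq_measure)
    then show "emeasure (distr M (count_space UNIV) (\<lambda>\<omega>. g E (\<lambda>b. \<epsilon> b \<omega>) p)) {a} = emeasure (measure_pmf p) {a}"
      by (subst emeasure_distr) (auto simp: emeasure_pmf_single vimage_def Int_def conj_commute)
  qed auto
qed

section \<open>Agreement of the indices for two probabilities\<close>

lemma prob_attains_both_ge:
  assumes p: "set_pmf p \<subseteq> E" and q: "set_pmf q \<subseteq> E" and a: "a \<in> E"
  shows "min (pmf p a) (pmf q a) / (1 + tv_dist E p q)
    \<le> prob {\<omega>\<in>space M. attains p \<omega> a \<and> attains q \<omega> a}"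
proof (cases "0 < pmf p a \<and> 0 < pmf q a")
  case True
  let ?m = "min (pmf p a) (pmf q a)"
  \<comment> \<open>\<open>c\<close> merges the constraints for \<open>p\<close> and
    \<open>q\<close> at \<open>a\<close>. It is dominated by \<open>C\<close>, which uses the
    smaller denominator and whose sum is known from \<open>has_sum_max_pmf\<close>.\<close>
  define c where "c b = max (pmf p b / pmf p a) (pmf q b / pmf q a)" for b
  define C where "C b = max (pmf p b) (pmf q b) / ?m" for b
  have C: "(C has_sum ((1 + tv_dist E p q) / ?m)) E"
    using has_sum_cmult_left[OF has_sum_max_pmf[OF p q], of "1 / ?m"] by (simp add: C_def[abs_def])
  have c0: "0 \<le> c b" for b
    by (simp add: c_def le_max_iff_disj)
  have cC: "c b \<le> C b" for b
    unfolding c_def C_def using True by (intro max.boundedI frac_le) (auto simp: le_max_iff_disj)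
  have "c summable_on E"
    by (rule summable_on_comparison_test[OF has_sum_imp_summable[OF C]]) (use c0 cC in auto)
  then have s: "(c has_sum infsum c E) E"
    by (rule has_sum_infsum)
  have le: "infsum c E \<le> (1 + tv_dist E p q) / ?m"
    by (rule has_sum_mono[OF s C]) (rule cC)
  have ca: "c a = 1"
    using True by (simp add: c_def)
  \<comment> \<open>The term at \<open>a\<close> keeps the sum positive, so that the upper bound
    \<open>le\<close> can be inverted.\<close>
  have "1 \<le> infsum c E"
    using finite_sum_le_has_sum[OF s, of "{a}"] a c0 ca by simp
  with le have "?m / (1 + tv_dist E p q) \<le> 1 / infsum c E"
    using True tv_dist_nonneg[of E p q] by (simp add: field_simps)
  also have "\<dots> = prob {\<omega>\<in>space M. \<forall>b\<in>E. 0 < c b \<longrightarrow> c b * \<epsilon> a \<omega> \<le> \<epsilon> b \<omega>}"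
    by (rule prob_exponential_le[OF countable_E a c0 ca s indep exponential, symmetric])
  also have "\<dots> \<le> prob {\<omega>\<in>space M. attains p \<omega> a \<and> attains q \<omega> a}"
  proof (rule finite_measure_mono_AE)
    show "AE \<omega> in M. \<omega> \<in> {\<omega>\<in>space M. \<forall>b\<in>E. 0 < c b \<longrightarrow> c b * \<epsilon> a \<omega> \<le> \<epsilon> b \<omega>}
        \<longrightarrow> \<omega> \<in> {\<omega>\<in>space M. attains p \<omega> a \<and> attains q \<omega> a}"
      using AE_clock_pos[OF a]
    proof eventually_elim
      case (elim \<omega>)
      show ?case
      proof
        assume "\<omega> \<in> {\<omega>\<in>space M. \<forall>b\<in>E. 0 < c b \<longrightarrow> c b * \<epsilon> a \<omega> \<le> \<epsilon> b \<omega>}"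
        then have \<omega>: "\<omega> \<in> space M" and c: "\<And>b. b \<in> E \<Longrightarrow> 0 < c b \<Longrightarrow> c b * \<epsilon> a \<omega> \<le> \<epsilon> b \<omega>"
          by auto
        \<comment> \<open>To be used with \<open>t\<close> equal to \<open>pmf p b / pmf p a\<close>
          and to the same quotient for \<open>q\<close>; both are at most
          \<open>c b\<close>.\<close>
        have le: "t * \<epsilon> a \<omega> \<le> \<epsilon> b \<omega>" if "b \<in> E" "0 < t" "t \<le> c b" for t b
        proof -
          have "t * \<epsilon> a \<omega> \<le> c b * \<epsilon> a \<omega>"
            using that elim by (intro mult_right_mono) auto
          also have "\<dots> \<le> \<epsilon> b \<omega>"
            using that by (intro c) auto
          finally show ?thesis .
        qed
        have "attains p \<omega> a"
          unfolding attains_inf_iff_scaled[OF a conjunct1[OF True]]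
          by (intro ballI impI le) (simp_all add: c_def)
        moreover have "attains q \<omega> a"
          unfolding attains_inf_iff_scaled[OF a conjunct2[OF True]]
          by (intro ballI impI le) (simp_all add: c_def)
        ultimately show "\<omega> \<in> {\<omega>\<in>space M. attains p \<omega> a \<and> attains q \<omega> a}"
          using \<omega> by simp
      qed
    qed
  qed measurable
  finally show ?thesis .
next
  case False
  then have "min (pmf p a) (pmf q a) = 0"
    using pmf_nonneg[of p a] pmf_nonneg[of q a] by linarith
  then show ?thesis by simp
qed

text \<open>The agreement event is the disjoint union over \<open>a\<close> of the events that both
  indices are \<open>a\<close>. Adding up the bounds of \<open>prob_attains_both_ge\<close> gives at
  least \<open>(1 - d) / (1 + d)\<close> for the distance \<open>d\<close>, and the complement of
  this is \<open>2 * d / (1 + d)\<close>.\<close>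

lemma prob_g_neq_le:
  assumes p: "set_pmf p \<subseteq> E" and q: "set_pmf q \<subseteq> E"
  shows "prob {\<omega>\<in>space M. g E (\<lambda>b. \<epsilon> b \<omega>) p \<noteq> g E (\<lambda>b. \<epsilon> b \<omega>) q}
    \<le> 2 * tv_dist E p q / (1 + tv_dist E p q)"
proof -
  have ne: "E \<noteq> {}" using p set_pmf_not_empty[of p] by auto
  let ?gp = "\<lambda>\<omega>. g E (\<lambda>b. \<epsilon> b \<omega>) p" and ?gq = "\<lambda>\<omega>. g E (\<lambda>b. \<epsilon> b \<omega>) q"
  let ?d = "tv_dist E p q"
  note [measurable] = measurable_g[OF ne, of p] measurable_g[OF ne, of q]
  have [measurable]: "{\<omega>\<in>space M. ?gp \<omega> = a \<and> ?gq \<omega> = a} \<in> events" for a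
  proof -
    have "{\<omega>\<in>space M. ?gp \<omega> = a \<and> ?gq \<omega> = a} = (?gp -` {a} \<inter> space M) \<inter> (?gq -` {a} \<inter> space M)"
      by auto
    also have "\<dots> \<in> events"
    proof (cases "a \<in> E")
      case True
      then show ?thesis
        using measurable_g[OF ne] by (auto simp: measurable_count_space_eq_countable[OF countable_E])
    next
      case False
      then have "?gp -` {a} = {}"
        using g_in[OF ne] by auto
      then show ?thesis by simp
    qed
    finally show ?thesis .
  qed
  have eq: "{\<omega>\<in>space M. ?gp \<omega> = ?gq \<omega>} = (\<Union>a\<in>E. {\<omega>\<in>space M. ?gp \<omega> = a \<and> ?gq \<omega> = a})"
    using g_in[OF ne] by auto
  have [measurable]: "{\<omega>\<in>space M. ?gp \<omega> = ?gq \<omega>} \<in> events"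
    unfolding eq by (intro sets.countable_UN' countable_E) auto
  have "(1 - ?d) * (1 / (1 + ?d)) \<le> prob {\<omega>\<in>space M. ?gp \<omega> = ?gq \<omega>}"
  \<comment> \<open>Bounding every finite partial sum suffices, so only finite additivity
    enters.\<close>
  proof (rule has_sum_le_finite_sums[OF has_sum_cmult_left[OF has_sum_min_pmf[OF p q]]])
    fix F assume F: "finite F" "F \<subseteq> E"
    have "(\<Sum>a\<in>F. min (pmf p a) (pmf q a) * (1 / (1 + ?d)))
        \<le> (\<Sum>a\<in>F. prob {\<omega>\<in>space M. ?gp \<omega> = a \<and> ?gq \<omega> = a})"
    proof (rule sum_mono)
      fix a assume "a \<in> F"
      then have "min (pmf p a) (pmf q a) / (1 + ?d) \<le> prob {\<omega>\<in>space M. attains p \<omega> a \<and> attains q \<omega> a}"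
        using F by (intro prob_attains_both_ge p q) auto
      also have "\<dots> = prob {\<omega>\<in>space M. ?gp \<omega> = a \<and> ?gq \<omega> = a}"
      proof (rule finite_measure_eq_AE)
        show "AE \<omega> in M. \<omega> \<in> {\<omega>\<in>space M. attains p \<omega> a \<and> attains q \<omega> a}
            \<longleftrightarrow> \<omega> \<in> {\<omega>\<in>space M. ?gp \<omega> = a \<and> ?gq \<omega> = a}"
          using AE_unique[OF p] AE_unique[OF q] by eventually_elim (auto simp: g_eq_iff)
      qed measurable
      finally show "min (pmf p a) (pmf q a) * (1 / (1 + ?d)) \<le> prob {\<omega>\<in>space M. ?gp \<omega> = a \<and> ?gq \<omega> = a}"
        by simp
    qed
    also have "\<dots> = prob (\<Union>a\<in>F. {\<omega>\<in>space M. ?gp \<omega> = a \<and> ?gq \<omega> = a})"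
      by (rule finite_measure_finite_Union[symmetric]) (use F in \<open>auto simp: disjoint_family_on_def\<close>)
    also have "\<dots> \<le> prob {\<omega>\<in>space M. ?gp \<omega> = ?gq \<omega>}"
      by (intro finite_measure_mono) auto
    finally show "(\<Sum>a\<in>F. min (pmf p a) (pmf q a) * (1 / (1 + ?d))) \<le> prob {\<omega>\<in>space M. ?gp \<omega> = ?gq \<omega>}" .
  qed
  moreover have "prob {\<omega>\<in>space M. ?gp \<omega> \<noteq> ?gq \<omega>} = 1 - prob {\<omega>\<in>space M. ?gp \<omega> = ?gq \<omega>}"
    by (rule prob_neg) simp
  moreover have "1 - (1 - ?d) * (1 / (1 + ?d)) = 2 * ?d / (1 + ?d)"
    using tv_dist_nonneg[of E p q] by (simp add: field_simps)
  ultimately show ?thesis by linarith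
qed

end

theorem proposition1p2:
  fixes M :: "'w measure" and E :: "'a set" and \<epsilon> :: "'a \<Rightarrow> 'w \<Rightarrow> real"
  assumes "prob_space M"
    and "countable E"
    and "prob_space.indep_vars M (\<lambda>_. borel) \<epsilon> E"
    and "\<And>a. a \<in> E \<Longrightarrow> distributed M lborel (\<epsilon> a) (\<lambda>x. ennreal (exponential_density 1 x))"
  shows "(\<forall>p. set_pmf p \<subseteq> E \<longrightarrow>
            (AE \<omega> in M. \<exists>!a. attains_inf E (\<lambda>b. \<epsilon> b \<omega>) p a))
       \<and> (\<forall>p. set_pmf p \<subseteq> E \<longrightarrow>
            (\<lambda>\<omega>. g E (\<lambda>b. \<epsilon> b \<omega>) p) \<in> measurable M (count_space E)
            \<and> distr M (count_space UNIV) (\<lambda>\<omega>. g E (\<lambda>b. \<epsilon> b \<omega>) p) = measure_pmf p)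
       \<and> (\<forall>p q. set_pmf p \<subseteq> E \<longrightarrow> set_pmf q \<subseteq> E \<longrightarrow>
            measure M {\<omega> \<in> space M. g E (\<lambda>b. \<epsilon> b \<omega>) p \<noteq> g E (\<lambda>b. \<epsilon> b \<omega>) q}
              \<le> 2 * tv_dist E p q / (1 + tv_dist E p q)
            \<and> 2 * tv_dist E p q / (1 + tv_dist E p q) \<le> 2 * tv_dist E p q)"
proof -
  interpret prob_space M by fact
  interpret exponential_clocks M E \<epsilon>
    by unfold_locales (use assms in auto)
  \<comment> \<open>A probability supported in \<open>E\<close> forces \<open>E\<close> to be
    nonempty, so the default value of \<open>g\<close> is a genuine element of
    \<open>E\<close>.\<close>
  have "E \<noteq> {}" if "set_pmf p \<subseteq> E" for p
    using that set_pmf_not_empty[of p] by auto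
  moreover have "2 * tv_dist E p q / (1 + tv_dist E p q) \<le> 2 * tv_dist E p q" for p q
    using tv_dist_nonneg[of E p q] by (simp add: divide_le_eq mult_le_cancel_left1)
  ultimately show ?thesis
    by (intro conjI allI impI AE_unique measurable_g distr_g prob_g_neq_le)
qed

end
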